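(* Let $T_t$ be a tree on $t$ vertices and let $3\le r\le t-1$. Suppose that $T_t$ has at least $t-r$ leaves sharing a common parent, i.e. there is a vertex of $T_t$ having at least $t-r$ neighbours of degree $1$ in $T_t$. Let $G$ be an $n$-vertex $T_t$-free graph. Then $$\rho_r(G)\le\binom{t-2}{r-1}.$$ If $n\ge t-1$, equality holds if and only if $K_{t-1}$ is a component of $G$ (i.e. some connected component of $G$ is isomorphic to $K_{t-1}$).
   Context: All graphs are finite, simple and undirected. $K_m$ is the complete graph on $m$ vertices. A graph $G$ is $F$-free if it contains no (not necessarily induced) subgraph isomorphic to $F$. A component is a maximal connected subgraph. A leaf is a vertex of degree $1$; its parent is its unique neighbour. For an integer $r\ge 2$, let $\mathcal C_r(G)$ be the family of $r$-cliques (copies of $K_r$) of $G$. For a graph $G$ with vertices indexed $1,\dots,n$, the $r$-clique tensor of $G$ is the order-$r$, dimension-$n$ symmetric tensor $\mathcal A_r(G)=(a_{i_1\ldots i_r})$ with $a_{i_1\ldots i_r}=\frac{1}{(r-1)!}$ if $\{i_1,\ldots,i_r\}\in\mathcal C_r(G)$ and $0$ otherwise. Its spectral radius is called the $r$-clique spectral radius $\rho_r(G)$. Equivalently (variational characterization), $$\rho_r(G)=\max\Big\{ r\sum_{\{i_1,\ldots,i_r\}\in\mathcal C_r(G)}x_{i_1}\cdots x_{i_r} : x_i\ge 0,\ \sum_{i=1}^n x_i^r=1\Big\}.$$ *)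

theory Defs
  imports Complex_Main "Graph_Theory.Graph_Theory"
begin

text \<open>
  A finite simple undirected graph is a \<^locale>\<open>pair_graph\<close>, i.e. a finite, loop-free, symmetric
  digraph whose arcs are pairs of vertices. An edge \<open>uv\<close> is thus present as both arcs \<open>(u,v)\<close> and
  \<open>(v,u)\<close>, and the degree of a vertex is its out-degree. \<^const>\<open>Digraph_Component.connected\<close> is
  written with its qualifier because topological connectedness has the same base name.
\<close>

text \<open>
  The library's \<^const>\<open>tree\<close> cannot be used for symmetric digraphs: there an edge traversed back
  and forth is already a cycle, so no symmetric digraph with an edge would be a tree. A
  \<^const>\<open>pre_digraph.cycle\<close> of length at least 3 is exactly a cycle of the undirected graph.
\<close>
definition undirected_tree :: "'a pair_pre_digraph \<Rightarrow> bool" where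
  "undirected_tree T \<longleftrightarrow>
     pair_graph T \<and> Digraph_Component.connected T \<and>
     \<not> (\<exists>p. pre_digraph.cycle T p \<and> length p \<ge> 3)"

definition is_leaf :: "'a pair_pre_digraph \<Rightarrow> 'a \<Rightarrow> bool" where
  "is_leaf G v \<longleftrightarrow> v \<in> pverts G \<and> out_degree G v = 1"

definition free_of :: "'b pair_pre_digraph \<Rightarrow> 'a pair_pre_digraph \<Rightarrow> bool" where
  "free_of F G \<longleftrightarrow> \<not> (\<exists>H. subgraph H (with_proj G) \<and> digraph_iso H (with_proj F))"

definition is_component :: "('a, 'a \<times> 'a) pre_digraph \<Rightarrow> 'a pair_pre_digraph \<Rightarrow> bool" where
  "is_component H G \<longleftrightarrow> pre_digraph.max_subgraph (with_proj G) Digraph_Component.connected H"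

text \<open>Cliques are identified with their vertex sets.\<close>
definition cliques :: "nat \<Rightarrow> 'a pair_pre_digraph \<Rightarrow> 'a set set" where
  "cliques r G =
     {S. S \<subseteq> pverts G \<and> card S = r \<and> (\<forall>u\<in>S. \<forall>v\<in>S. u \<noteq> v \<longrightarrow> (u, v) \<in> parcs G)}"

text \<open>
  A real tensor of order \<open>m\<close> over a finite index set \<open>I\<close> (so of dimension \<open>card I\<close>) is a function on
  index lists; only its values on lists of length \<open>m\<close> over \<open>I\<close> matter. The next definition is the
  \<open>i\<close>-th entry of the vector $A x^{m-1}$, that is, the sum of
  $a_{i j_2 \ldots j_m} x_{j_2} \cdots x_{j_m}$ over all $j_2, \ldots, j_m$.
\<close>
definition tensor_apply ::
  "'i set \<Rightarrow> nat \<Rightarrow> ('i list \<Rightarrow> real) \<Rightarrow> ('i \<Rightarrow> complex) \<Rightarrow> 'i \<Rightarrow> complex" where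
  "tensor_apply I m A x i =
     (\<Sum>js | set js \<subseteq> I \<and> length js = m - 1.
        complex_of_real (A (i # js)) * prod_list (map x js))"

text \<open>
  Eigenvalues in the sense of Qi and Lim: $A x^{m-1} = \lambda x^{[m-1]}$ for a nonzero complex
  vector \<open>x\<close>, where $x^{[m-1]}$ is the entrywise power.
\<close>
definition tensor_eigenvalue :: "'i set \<Rightarrow> nat \<Rightarrow> ('i list \<Rightarrow> real) \<Rightarrow> complex \<Rightarrow> bool" where
  "tensor_eigenvalue I m A l \<longleftrightarrow>
     (\<exists>x. (\<exists>i\<in>I. x i \<noteq> 0) \<and> (\<forall>i\<in>I. tensor_apply I m A x i = l * x i ^ (m - 1)))"

text \<open>
  The largest modulus of an eigenvalue. A tensor of dimension 0 has no eigenvalues; its spectral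
  radius is 0 by convention.
\<close>
definition tensor_spectral_radius :: "'i set \<Rightarrow> nat \<Rightarrow> ('i list \<Rightarrow> real) \<Rightarrow> real" where
  "tensor_spectral_radius I m A =
     (if I = {} then 0 else Sup (cmod ` {l. tensor_eigenvalue I m A l}))"

text \<open>The tensor is indexed by the vertices themselves instead of by a numbering of them.\<close>
definition clique_tensor :: "nat \<Rightarrow> 'a pair_pre_digraph \<Rightarrow> 'a list \<Rightarrow> real" where
  "clique_tensor r G vs =
     (if length vs = r \<and> set vs \<in> cliques r G then 1 / fact (r - 1) else 0)"

definition clique_spectral_radius :: "nat \<Rightarrow> 'a pair_pre_digraph \<Rightarrow> real" where
  "clique_spectral_radius r G = tensor_spectral_radius (pverts G) r (clique_tensor r G)"

end

theory Submission
  imports Defs "HOL-Combinatorics.Multiset_Permutations"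
begin

text \<open>
  Everything follows from a local count. Row \<open>i\<close> of the clique tensor sums to the number of
  \<open>r\<close>-cliques through \<open>i\<close>, the clique degree of \<open>i\<close>. As in the Perron--Frobenius row-sum bound,
  comparing the two sides of the eigenvalue equation at an entry of largest modulus bounds every
  eigenvalue by a clique degree (\<open>cmod_eigenvalue_le_clique_degree\<close>).

  The tree controls clique degrees as follows. Delete \<open>t - r\<close> leaves at the special vertex \<open>v\<close>;
  what is left of \<open>T\<close> has \<open>r\<close> vertices and fits into any \<open>r\<close>-clique, with \<open>v\<close> placed on any
  chosen vertex \<open>u\<close> of it. If \<open>u\<close> had \<open>t - 1\<close> neighbours, \<open>t - r\<close> of them would lie outside the
  clique and could serve as the deleted leaves. Hence in a \<open>T\<close>-free graph each vertex of an
  \<open>r\<close>-clique has at most \<open>t - 2\<close> neighbours (\<open>degree_less_if_free_of\<close>), and so clique degree at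
  most \<open>(t - 2) choose (r - 1)\<close>.

  A vertex \<open>u\<close> attaining this clique degree has exactly \<open>t - 2\<close> neighbours, any \<open>r - 1\<close> of which
  form a clique; since \<open>r - 1 \<ge> 2\<close>, they are pairwise adjacent and \<open>u\<close> lies in a \<open>(t - 1)\<close>-clique.
  Each vertex of that clique is in an \<open>r\<close>-clique too, so its \<open>t - 2\<close> neighbours inside the clique
  are all it has, and the clique is a component. Without such a component all clique degrees are
  smaller than the bound by at least one, and so is the spectral radius. Conversely, the indicator
  vector of a component \<open>K\<^bsub>t-1\<^esub>\<close> is an eigenvector whose eigenvalue is the bound.
\<close>

section \<open>Eigenvalues of the clique tensor\<close>

text \<open>
  A clique \<open>S\<close> through \<open>i\<close> occurs once for each ordering of \<open>S - {i}\<close>; these \<open>(r - 1)!\<close> orderings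
  cancel the normalisation of the tensor.
\<close>
lemma tensor_apply_clique_tensor:
  assumes fin: "finite (pverts G)" and r: "1 \<le> r"
  shows "tensor_apply (pverts G) r (clique_tensor r G) x i =
    (\<Sum>S | S \<in> cliques r G \<and> i \<in> S. \<Prod>j\<in>S - {i}. x j)"
proof -
  let ?C = "{S \<in> cliques r G. i \<in> S}"
  let ?J = "{js. set js \<subseteq> pverts G \<and> length js = r - 1}"
  let ?f = "\<lambda>js. complex_of_real (clique_tensor r G (i # js)) * prod_list (map x js)"
  have finS: "finite S" and cardS: "card (S - {i}) = r - 1" if "S \<in> ?C" for S
    using that fin by (auto simp: cliques_def intro: finite_subset)
  have finC: "finite ?C"
    by (rule finite_subset[of _ "Pow (pverts G)"]) (auto simp: cliques_def fin)
  have finJ: "finite ?J" using finite_lists_length_eq[OF fin] by simp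
  \<comment> \<open>A list of \<open>r\<close> vertices covering an \<open>r\<close>-clique cannot repeat a vertex.\<close>
  have perm: "js \<in> permutations_of_set (S - {i})"
    if "S \<in> ?C" "set (i # js) = S" "length js = r - 1" for S js
  proof -
    have "distinct (i # js)"
      using that r by (intro card_distinct) (auto simp: cliques_def)
    then show ?thesis using that by (auto simp: permutations_of_set_def)
  qed
  have nonzero: "?f js = prod x (S - {i}) / fact (r - 1)" "js \<in> ?J" "set (i # js) = S"
    if "S \<in> ?C" "js \<in> permutations_of_set (S - {i})" for S js
  proof -
    have js: "set js = S - {i}" "distinct js"
      using that by (auto simp: permutations_of_set_def)
    then have len: "length js = r - 1" using cardS[OF that(1)] distinct_card by metis
    show eq: "set (i # js) = S" using js that by auto
    show "js \<in> ?J" using js len that by (auto simp: cliques_def)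
    have "prod_list (map x js) = prod x (S - {i})"
      using prod.distinct_set_conv_list[OF js(2), of x] js(1) by simp
    then show "?f js = prod x (S - {i}) / fact (r - 1)"
      using that(1) eq len r by (simp add: clique_tensor_def)
  qed
  have "sum ?f ?J = sum ?f (\<Union>S\<in>?C. permutations_of_set (S - {i}))"
  proof (rule sum.mono_neutral_right[OF finJ])
    show "(\<Union>S\<in>?C. permutations_of_set (S - {i})) \<subseteq> ?J" using nonzero(2) by blast
    show "\<forall>js\<in>?J - (\<Union>S\<in>?C. permutations_of_set (S - {i})). ?f js = 0"
    proof
      fix js assume js: "js \<in> ?J - (\<Union>S\<in>?C. permutations_of_set (S - {i}))"
      have "set (i # js) \<notin> cliques r G"
        using js perm[of "set (i # js)" js] by auto
      then show "?f js = 0" by (simp add: clique_tensor_def)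
    qed
  qed
  also have "\<dots> = (\<Sum>S\<in>?C. sum ?f (permutations_of_set (S - {i})))"
  proof (rule sum.UNION_disjoint[OF finC])
    show "\<forall>S\<in>?C. \<forall>S'\<in>?C. S \<noteq> S' \<longrightarrow>
        permutations_of_set (S - {i}) \<inter> permutations_of_set (S' - {i}) = {}"
      using nonzero(3) by blast
  qed simp
  also have "\<dots> = (\<Sum>S\<in>?C. prod x (S - {i}))"
  proof (rule sum.cong)
    fix S assume S: "S \<in> ?C"
    have "sum ?f (permutations_of_set (S - {i})) =
        (\<Sum>js\<in>permutations_of_set (S - {i}). prod x (S - {i}) / fact (r - 1))"
      using nonzero(1)[OF S] by (intro sum.cong) auto
    also have "\<dots> = prod x (S - {i})"
      using finS[OF S] cardS[OF S] by simp
    finally show "sum ?f (permutations_of_set (S - {i})) = prod x (S - {i})" .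
  qed simp
  finally show ?thesis by (simp add: tensor_apply_def)
qed

definition clique_degree :: "nat \<Rightarrow> 'a pair_pre_digraph \<Rightarrow> 'a \<Rightarrow> nat" where
  "clique_degree r G i = card {S \<in> cliques r G. i \<in> S}"

text \<open>
  At an entry \<open>x i\<close> of largest modulus, each clique through \<open>i\<close> contributes at most
  \<open>cmod (x i) ^ (r - 1)\<close> to the eigenvalue equation.
\<close>
lemma cmod_eigenvalue_le_clique_degree:
  assumes fin: "finite (pverts G)" and r: "1 \<le> r"
    and eig: "tensor_eigenvalue (pverts G) r (clique_tensor r G) l"
  shows "\<exists>i\<in>pverts G. cmod l \<le> real (clique_degree r G i)"
proof -
  obtain x k where k: "k \<in> pverts G" "x k \<noteq> 0" and
    x: "\<And>i. i \<in> pverts G \<Longrightarrow>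
      tensor_apply (pverts G) r (clique_tensor r G) x i = l * x i ^ (r - 1)"
    using eig by (auto simp: tensor_eigenvalue_def)
  let ?m = "Max ((\<lambda>i. cmod (x i)) ` pverts G)"
  have "?m \<in> (\<lambda>i. cmod (x i)) ` pverts G" using fin k by (intro Max_in) auto
  then obtain i where i: "i \<in> pverts G" "?m = cmod (x i)" by auto
  have max: "cmod (x j) \<le> cmod (x i)" if "j \<in> pverts G" for j
    using that fin i(2) by (metis Max_ge finite_imageI imageI)
  have pos: "0 < cmod (x i)" using max[OF k(1)] k(2) by (smt (verit) zero_less_norm_iff)
  have "cmod l * cmod (x i) ^ (r - 1) =
      cmod (\<Sum>S | S \<in> cliques r G \<and> i \<in> S. \<Prod>j\<in>S - {i}. x j)"
    using x[OF i(1)] by (simp add: tensor_apply_clique_tensor[OF fin r] norm_mult norm_power)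
  also have "\<dots> \<le> (\<Sum>S | S \<in> cliques r G \<and> i \<in> S. cmod (x i) ^ (r - 1))"
  proof (rule sum_norm_le)
    fix S assume "S \<in> {S. S \<in> cliques r G \<and> i \<in> S}"
    then have S: "S \<subseteq> pverts G" "card (S - {i}) = r - 1"
      using fin by (auto simp: cliques_def intro: finite_subset)
    have "cmod (\<Prod>j\<in>S - {i}. x j) = (\<Prod>j\<in>S - {i}. cmod (x j))" by (rule prod_norm[symmetric])
    also have "\<dots> \<le> (\<Prod>j\<in>S - {i}. cmod (x i))"
      using S max by (intro prod_mono) auto
    finally show "cmod (\<Prod>j\<in>S - {i}. x j) \<le> cmod (x i) ^ (r - 1)" using S by simp
  qed
  also have "\<dots> = real (clique_degree r G i) * cmod (x i) ^ (r - 1)"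
    by (simp add: clique_degree_def)
  finally have "cmod l \<le> real (clique_degree r G i)" using pos by simp
  then show ?thesis using i by blast
qed

text \<open>
  Ensures that the spectral radius is a supremum over a nonempty set. A unit vector works: for
  \<open>r \<ge> 3\<close>, the clique products run over at least two vertices, one of which carries the entry 0.
\<close>
lemma zero_eigenvalue_clique_tensor:
  assumes fin: "finite (pverts G)" and r: "3 \<le> r" and k: "k \<in> pverts G"
  shows "tensor_eigenvalue (pverts G) r (clique_tensor r G) 0"
proof -
  let ?x = "\<lambda>i. if i = k then 1 else 0 :: complex"
  have "tensor_apply (pverts G) r (clique_tensor r G) ?x i = 0" for i
  proof -
    have "(\<Prod>j\<in>S - {i}. ?x j) = 0" if S: "S \<in> cliques r G" "i \<in> S" for S
    proof -
      have fS: "finite S" using S fin by (auto simp: cliques_def intro: finite_subset)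
      have "\<not> S - {i} \<subseteq> {k}"
      proof
        assume "S - {i} \<subseteq> {k}"
        then have "card S \<le> card {i, k}" by (intro card_mono) auto
        then show False using S r by (auto simp: cliques_def card_insert_if split: if_splits)
      qed
      then show ?thesis using fS by (auto simp: prod_zero_iff)
    qed
    then show ?thesis using fin r by (simp add: tensor_apply_clique_tensor)
  qed
  then show ?thesis using k unfolding tensor_eigenvalue_def
    by (intro exI[of _ ?x]) (use r in auto)
qed

lemma clique_spectral_radius_le:
  assumes "finite (pverts G)" "3 \<le> r"
    and deg: "\<And>i. i \<in> pverts G \<Longrightarrow> clique_degree r G i \<le> c"
  shows "clique_spectral_radius r G \<le> real c"
proof (cases "pverts G = {}")
  case False
  have "cmod l \<le> real c" if "tensor_eigenvalue (pverts G) r (clique_tensor r G) l" for l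
    using cmod_eigenvalue_le_clique_degree[OF assms(1) _ that] deg assms(2)
    by (meson le_trans numeral_le_one_iff of_nat_le_iff one_le_numeral order_trans)
  moreover have "{l. tensor_eigenvalue (pverts G) r (clique_tensor r G) l} \<noteq> {}"
    using zero_eigenvalue_clique_tensor[OF assms(1,2)] False by fast
  ultimately show ?thesis using False
    by (auto simp: clique_spectral_radius_def tensor_spectral_radius_def intro!: cSup_least)
qed (simp add: clique_spectral_radius_def tensor_spectral_radius_def)

text \<open>
  Finitely many clique degrees bound all moduli, so their supremum exists and dominates each one.
\<close>
lemma cmod_eigenvalue_le_clique_spectral_radius:
  assumes fin: "finite (pverts G)" and r: "1 \<le> r"
    and eig: "tensor_eigenvalue (pverts G) r (clique_tensor r G) l"
  shows "cmod l \<le> clique_spectral_radius r G"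
proof -
  let ?E = "{l. tensor_eigenvalue (pverts G) r (clique_tensor r G) l}"
  have "pverts G \<noteq> {}" using eig by (auto simp: tensor_eigenvalue_def)
  moreover have "bdd_above (cmod ` ?E)"
  proof (rule bdd_above.I2)
    fix l assume "l \<in> ?E"
    then obtain i where "i \<in> pverts G" "cmod l \<le> real (clique_degree r G i)"
      using cmod_eigenvalue_le_clique_degree[OF fin r] by blast
    then show "cmod l \<le> real (\<Sum>i\<in>pverts G. clique_degree r G i)"
      using fin by (meson member_le_sum le0 of_nat_le_iff order_trans)
  qed
  ultimately show ?thesis using eig
    by (auto simp: clique_spectral_radius_def tensor_spectral_radius_def intro!: cSup_upper)
qed

section \<open>Degrees and cliques\<close>

definition neighbours :: "'a pair_pre_digraph \<Rightarrow> 'a \<Rightarrow> 'a set" where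
  "neighbours G u = {w. (u, w) \<in> parcs G}"

lemma neighbours_basics:
  assumes "pair_graph G"
  shows "finite (neighbours G u)" "neighbours G u \<subseteq> pverts G" "u \<notin> neighbours G u"
proof -
  interpret pair_graph G by fact
  show sub: "neighbours G u \<subseteq> pverts G" by (auto simp: neighbours_def dest: in_arcsD2)
  show "finite (neighbours G u)" using sub pair_finite_verts by (rule finite_subset)
  show "u \<notin> neighbours G u" by (auto simp: neighbours_def dest: no_loops')
qed

lemma clique_through_vertex:
  assumes S: "S \<in> cliques r G" "u \<in> S"
  shows "S - {u} \<subseteq> neighbours G u" "card (S - {u}) = r - 1"
proof -
  show "S - {u} \<subseteq> neighbours G u" using S by (auto simp: cliques_def neighbours_def)
  show "card (S - {u}) = r - 1" using S by (simp add: cliques_def card_Diff_singleton)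
qed

text \<open>
  Removing \<open>u\<close> turns the \<open>r\<close>-cliques through \<open>u\<close> injectively into \<open>(r - 1)\<close>-sets of neighbours. The
  clique degree is therefore at most a binomial coefficient, with equality only if every such set
  arises.
\<close>
lemma clique_links:
  shows "(\<lambda>S. S - {u}) ` {S \<in> cliques r G. u \<in> S} \<subseteq>
      {Q. Q \<subseteq> neighbours G u \<and> card Q = r - 1}"
    and "card ((\<lambda>S. S - {u}) ` {S \<in> cliques r G. u \<in> S}) = clique_degree r G u"
  using clique_through_vertex[of _ r G u] unfolding clique_degree_def
  by (auto intro!: card_image inj_onI)

lemma clique_degree_le_choose:
  assumes "pair_graph G"
  shows "clique_degree r G u \<le> card (neighbours G u) choose (r - 1)"
  using card_mono[OF _ clique_links(1)[of u r G]] neighbours_basics(1)[OF assms, of u]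
  by (simp add: clique_links(2) n_subsets)

text \<open>
  With equality in the binomial bound, every \<open>(r - 1)\<close>-set of neighbours of \<open>u\<close> comes from a
  clique. As \<open>r - 1 \<ge> 2\<close>, any two neighbours lie in such a set and are therefore adjacent.
\<close>
lemma clique_of_clique_degree_eq:
  assumes G: "pair_graph G" and u: "u \<in> pverts G" and r: "3 \<le> r" "r - 1 \<le> card (neighbours G u)"
    and eq: "clique_degree r G u = card (neighbours G u) choose (r - 1)"
  shows "insert u (neighbours G u) \<in> cliques (Suc (card (neighbours G u))) G"
proof -
  interpret pair_graph G by fact
  let ?N = "neighbours G u"
  note N = neighbours_basics[OF G, of u]
  have all: "(\<lambda>S. S - {u}) ` {S \<in> cliques r G. u \<in> S} = {Q. Q \<subseteq> ?N \<and> card Q = r - 1}"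
    using clique_links[of u r G] N(1)
    by (intro card_subset_eq) (auto simp: n_subsets eq)
  have "(a, b) \<in> parcs G" if ab: "a \<in> ?N" "b \<in> ?N" "a \<noteq> b" for a b
  proof -
    have "\<exists>Q. {a, b} \<subseteq> Q \<and> Q \<subseteq> ?N \<and> card Q = r - 1"
      using ab r N(1) by (intro exists_subset_between) auto
    then obtain Q where Q: "a \<in> Q" "b \<in> Q" "Q \<subseteq> ?N" "card Q = r - 1" by auto
    then have "Q \<in> (\<lambda>S. S - {u}) ` {S \<in> cliques r G. u \<in> S}" by (simp add: all)
    then show ?thesis using Q ab by (auto simp: cliques_def)
  qed
  then show ?thesis using N u by (auto simp: cliques_def neighbours_def intro: arcs_symmetric)
qed

section \<open>Embedding the tree\<close>

lemma not_free_of_if_embedding: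
  assumes T: "pair_graph T" and G: "pair_graph G"
    and inj: "inj_on f (pverts T)" and verts: "f ` pverts T \<subseteq> pverts G"
    and arcs: "\<And>a b. (a, b) \<in> parcs T \<Longrightarrow> (f a, f b) \<in> parcs G"
  shows "\<not> free_of T G"
proof -
  interpret T: pair_graph T by fact
  interpret G: pair_graph G by fact
  let ?h = "\<lparr>iso_verts = f, iso_arcs = map_prod f f, iso_head = snd, iso_tail = fst\<rparr>"
  let ?H = "app_iso ?h (with_proj T)"
  have "parcs T \<subseteq> pverts T \<times> pverts T" using T.wellformed' by auto
  then have "inj_on (map_prod f f) (parcs T)"
    using map_prod_inj_on[OF inj inj] inj_on_subset by blast
  then have h: "pre_digraph.digraph_isomorphism (with_proj T) ?h"
    using inj T.wf_digraph_axioms by (simp add: pre_digraph.digraph_isomorphism_def)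
  then have "digraph_iso (with_proj T) ?H" by (auto simp: digraph_iso_def)
  then have "digraph_iso ?H (with_proj T)"
    by (rule digraph_iso_swap[OF T.wf_digraph_axioms])
  moreover have "subgraph ?H (with_proj G)"
    using verts arcs h T.wf_digraphI_app_iso G.wf_digraph_axioms
    by (auto simp: subgraph_def compatible_def)
  ultimately show ?thesis by (auto simp: free_of_def)
qed

lemma leaf_neighbour_unique:
  assumes T: "pair_graph T" and "is_leaf T w" "(v, w) \<in> parcs T" "(w, b) \<in> parcs T"
  shows "b = v"
proof -
  interpret pair_graph T by fact
  have "card {e \<in> parcs T. fst e = w} = 1"
    using assms(2) by (simp add: is_leaf_def out_degree_def out_arcs_def)
  then obtain e where e: "{e \<in> parcs T. fst e = w} = {e}" by (auto simp: card_1_singleton_iff)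
  have "(w, v) \<in> {e \<in> parcs T. fst e = w}" "(w, b) \<in> {e \<in> parcs T. fst e = w}"
    using arcs_symmetric[OF assms(3)] assms(4) by simp_all
  then have "(w, v) = (w, b)" unfolding e by simp
  then show ?thesis by simp
qed

text \<open>
  Otherwise \<open>T\<close> embeds: \<open>v\<close> goes to \<open>u\<close>, a set \<open>L\<close> of \<open>t - r\<close> leaves at \<open>v\<close> goes to neighbours of
  \<open>u\<close> outside the clique \<open>K\<close>, and the other vertices go to \<open>K - {u}\<close> in any way. Adjacencies among
  the latter and \<open>v\<close> are preserved because \<open>K\<close> is complete, and a vertex of \<open>L\<close> is adjacent to \<open>v\<close>
  only.
\<close>
lemma degree_less_if_free_of:
  assumes T: "pair_graph T" "card (pverts T) = t" and r: "1 \<le> r" "r \<le> t"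
    and v: "v \<in> pverts T" "t - r \<le> card {w. (v, w) \<in> parcs T \<and> is_leaf T w}"
    and G: "pair_graph G" and free: "free_of T G"
    and K: "K \<in> cliques r G" "u \<in> K"
  shows "card (neighbours G u) < t - 1"
proof (rule ccontr)
  assume deg: "\<not> card (neighbours G u) < t - 1"
  interpret T: pair_graph T by fact
  interpret G: pair_graph G by fact
  obtain L where L: "L \<subseteq> {w. (v, w) \<in> parcs T \<and> is_leaf T w}" "card L = t - r" "finite L"
    by (rule obtain_subset_with_card_n[OF v(2)])
  have Lv: "L \<subseteq> pverts T" "v \<notin> L"
    using L(1) T.wellformed' T.no_loops' by blast+
  have Kfin: "finite K" and KV: "K \<subseteq> pverts G" "card K = r"
    using K G.pair_finite_verts by (auto simp: cliques_def intro: finite_subset)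
  let ?R = "pverts T - L"
  have "card ?R = r" using T(2) L r Lv by (simp add: card_Diff_subset)
  then have "card (?R - {v}) = card (K - {u})" using v(1) Lv K(2) KV by simp
  then obtain g where g: "bij_betw g (?R - {v}) (K - {u})"
    using finite_same_card_bij[of "?R - {v}" "K - {u}"] T.pair_finite_verts Kfin by blast
  have "t - r \<le> card (neighbours G u - K)"
  proof -
    have "neighbours G u - K = neighbours G u - (K - {u})"
      using neighbours_basics(3)[OF G] by auto
    moreover have "card (neighbours G u - (K - {u})) = card (neighbours G u) - (r - 1)"
      using clique_through_vertex[OF K] Kfin by (simp add: card_Diff_subset)
    ultimately show ?thesis using deg r by simp
  qed
  then obtain M where M: "M \<subseteq> neighbours G u - K" "card M = t - r" "finite M"
    by (rule obtain_subset_with_card_n)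
  then obtain h where h: "bij_betw h L M"
    using finite_same_card_bij[of L M] L by auto
  define f where "f w = (if w \<in> L then h w else if w = v then u else g w)" for w
  have fL: "f w \<in> M" if "w \<in> L" for w
    using that h by (auto simp: f_def bij_betw_def)
  have fv: "f v = u" using Lv by (simp add: f_def)
  have "inj_on f L" using h by (auto simp: f_def bij_betw_def inj_on_def)
  have fR: "inj_on f ?R" "f ` ?R \<subseteq> K"
    using g K(2) by (auto simp: f_def bij_betw_def inj_on_def)
  have inj: "inj_on f (pverts T)"
  proof -
    have "inj_on f (L \<union> ?R)"
      using \<open>inj_on f L\<close> fR fL M(1) by (subst inj_on_Un) blast
    then show ?thesis using Lv by (simp add: Un_absorb1)
  qed
  have MV: "M \<subseteq> pverts G" using M(1) neighbours_basics(2)[OF G] by blast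
  have "\<not> free_of T G"
  proof (rule not_free_of_if_embedding[OF T(1) G inj])
    show "f ` pverts T \<subseteq> pverts G" using fL fR(2) MV KV(1) by blast
    fix a b assume ab: "(a, b) \<in> parcs T"
    have V: "a \<in> pverts T" "b \<in> pverts T" "a \<noteq> b"
      using ab T.wellformed' T.no_loops' by auto
    have leaf: "(u, f w) \<in> parcs G" if "w \<in> L" for w
      using fL[OF that] M(1) by (auto simp: neighbours_def)
    consider "a \<in> L" | "b \<in> L" | "a \<in> ?R" "b \<in> ?R" using V by blast
    then show "(f a, f b) \<in> parcs G"
    proof cases
      case 1
      then have "b = v" using leaf_neighbour_unique[OF T(1)] L(1) ab by blast
      then show ?thesis using leaf[OF 1] fv G.arcs_symmetric by simp
    next
      case 2
      then have "a = v"
        using leaf_neighbour_unique[OF T(1)] L(1) T.arcs_symmetric[OF ab] by blast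
      then show ?thesis using leaf[OF 2] fv by simp
    next
      case 3
      then have "f a \<noteq> f b" using fR(1) V(3) by (auto simp: inj_on_def)
      moreover have "f a \<in> K" "f b \<in> K" using 3 fR(2) by blast+
      ultimately show ?thesis using K(1) by (auto simp: cliques_def)
    qed
  qed
  then show False using free by simp
qed

section \<open>Complete components\<close>

definition closed_in :: "'a set \<Rightarrow> 'a pair_pre_digraph \<Rightarrow> bool" where
  "closed_in S G \<longleftrightarrow> (\<forall>a\<in>S. neighbours G a \<subseteq> S)"

text \<open>
  A walk starting in \<open>S\<close> cannot leave \<open>S\<close>, so a connected subgraph containing the complete graph on
  \<open>S\<close> has no further vertices, and no further arcs are possible.
\<close>
lemma complete_component_of_closed_clique:
  assumes G: "pair_graph G" and S: "S \<in> cliques m G" "S \<noteq> {}" and closed: "closed_in S G"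
  shows "\<exists>H. is_component H G \<and> complete_digraph m H"
proof -
  interpret G: pair_graph G by fact
  let ?P = "\<lparr>pverts = S, parcs = {(a, b). a \<in> S \<and> b \<in> S \<and> a \<noteq> b}\<rparr>"
  let ?H = "with_proj ?P"
  have SV: "S \<subseteq> pverts G" "card S = m" and clique: "\<And>a b. a \<in> S \<Longrightarrow> b \<in> S \<Longrightarrow> a \<noteq> b \<Longrightarrow> (a, b) \<in> parcs G"
    using S by (auto simp: cliques_def)
  have fin: "finite S" using SV G.pair_finite_verts by (auto intro: finite_subset)
  have complete: "complete_digraph m ?H"
    using fin SV by (auto simp: complete_digraph_pair_def)
  then have graphH: "graph ?H" by (simp add: complete_digraph_def)
  then interpret H: graph ?H .
  have wfH: "wf_digraph ?H" by (rule H.wf_digraph)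
  have sub: "subgraph ?H (with_proj G)"
    using SV clique wfH G.wf_digraph_axioms by (auto simp: subgraph_def compatible_def)
  have conn: "Digraph_Component.connected ?H"
  proof -
    have "a \<rightarrow>\<^sup>*\<^bsub>?H\<^esub> b" if "a \<in> S" "b \<in> S" for a b
    proof (cases "a = b")
      case True then show ?thesis using that H.reachable_refl[of b] by simp
    next
      case False then show ?thesis using that by (intro H.reachable_adjI) simp
    qed
    then show ?thesis using S(2)
      by (auto simp: Digraph_Component.connected_def strongly_connected_def
        intro!: H.reachable_mk_symmetricI)
  qed
  have "H' = ?H" if H': "subgraph ?H H'" "subgraph H' (with_proj G)" "Digraph_Component.connected H'" for H'
  proof -
    have ht: "tail H' = fst" "head H' = snd"
      using H'(2) by (auto simp: subgraph_def compatible_def)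
    have arcs: "arcs H' \<subseteq> parcs G" and sup: "S \<subseteq> verts H'" "parcs ?P \<subseteq> arcs H'" and wf: "wf_digraph H'"
      using H' by (auto simp: subgraph_def)
    obtain a where a: "a \<in> S" using S(2) by auto
    have "b \<in> S" if "b \<in> verts H'" for b
    proof -
      have "a \<rightarrow>\<^sup>*\<^bsub>mk_symmetric H'\<^esub> b"
        using H'(3) a sup that by (auto simp: Digraph_Component.connected_def strongly_connected_def)
      then have "(a, b) \<in> (parcs (mk_symmetric H'))\<^sup>*"
        using reachable_rtranclI by fastforce
      then show ?thesis
      proof (induction rule: rtrancl_induct)
        case (step y z)
        then have "(y, z) \<in> parcs G"
          using arcs by (auto simp: parcs_mk_symmetric ht intro: G.arcs_symmetric)
        then show ?case using step closed by (auto simp: closed_in_def neighbours_def)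
      qed (rule a)
    qed
    then have V: "verts H' = S" using sup by auto
    have "arcs H' = parcs ?P"
    proof
      show "arcs H' \<subseteq> parcs ?P"
      proof
        fix e assume e: "e \<in> arcs H'"
        then have "fst e \<in> S" "snd e \<in> S" "fst e \<noteq> snd e"
          using wf_digraph.tail_in_verts[OF wf e] wf_digraph.head_in_verts[OF wf e]
            arcs G.pair_no_loops by (auto simp: V ht)
        then show "e \<in> parcs ?P" by (cases e) simp
      qed
    qed (rule sup)
    then show ?thesis using V ht by (simp add: with_proj_def)
  qed
  then have "is_component ?H G"
    using sub conn unfolding is_component_def pre_digraph.max_subgraph_def by blast
  then show ?thesis using complete by blast
qed

lemma clique_of_complete_component:
  assumes "is_component H G" "complete_digraph m H"
  shows "verts H \<in> cliques m G" "verts H \<noteq> {}"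
proof -
  have H: "subgraph H (with_proj G)" "Digraph_Component.connected H"
    using assms(1) by (auto simp: is_component_def pre_digraph.max_subgraph_def)
  have "arcs_ends H \<subseteq> parcs G" using arcs_ends_mono[OF H(1)] by simp
  then show "verts H \<in> cliques m G"
    using assms(2) H(1) by (auto simp: cliques_def complete_digraph_def subgraph_def)
  show "verts H \<noteq> {}"
    using H(2) by (auto simp: Digraph_Component.connected_def strongly_connected_def)
qed

text \<open>
  The eigenvector is the indicator of \<open>S\<close>. A clique through a vertex of \<open>S\<close> stays inside \<open>S\<close>, so its
  product is 1; a clique through any other vertex avoids \<open>S\<close>, so its product is 0.
\<close>
lemma eigenvalue_of_closed_clique:
  assumes G: "pair_graph G" and S: "S \<in> cliques m G" "S \<noteq> {}" and closed: "closed_in S G"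
    and r: "2 \<le> r"
  shows "tensor_eigenvalue (pverts G) r (clique_tensor r G) (of_nat ((m - 1) choose (r - 1)))"
proof -
  interpret G: pair_graph G by fact
  let ?x = "\<lambda>i. if i \<in> S then 1 else 0 :: complex"
  let ?C = "\<lambda>i. {Q. Q \<in> cliques r G \<and> i \<in> Q}"
  have SV: "S \<subseteq> pverts G" "card S = m" using S by (auto simp: cliques_def)
  have fin: "finite S" using SV G.pair_finite_verts by (auto intro: finite_subset)
  have row: "tensor_apply (pverts G) r (clique_tensor r G) ?x i =
      of_nat ((m - 1) choose (r - 1)) * ?x i ^ (r - 1)" for i
  proof (cases "i \<in> S")
    case True
    have N: "neighbours G i = S - {i}"
      using closed S True neighbours_basics(3)[OF G]
      by (auto simp: closed_in_def neighbours_def cliques_def)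
    have "(\<Sum>Q\<in>?C i. \<Prod>j\<in>Q - {i}. ?x j) = (\<Sum>Q\<in>?C i. 1)"
    proof (rule sum.cong)
      fix Q assume "Q \<in> ?C i"
      then have "Q - {i} \<subseteq> S" using clique_through_vertex(1)[of Q r G i] N by blast
      then show "(\<Prod>j\<in>Q - {i}. ?x j) = 1" by (intro prod.neutral) auto
    qed simp
    also have "\<dots> = of_nat (clique_degree r G i)" by (simp add: clique_degree_def)
    also have "clique_degree r G i = (m - 1) choose (r - 1)"
    proof -
      have "(\<lambda>Q. Q - {i}) ` ?C i = {Q. Q \<subseteq> S - {i} \<and> card Q = r - 1}"
      proof
        show "{Q. Q \<subseteq> S - {i} \<and> card Q = r - 1} \<subseteq> (\<lambda>Q. Q - {i}) ` ?C i"
        proof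
          fix Q assume Q: "Q \<in> {Q. Q \<subseteq> S - {i} \<and> card Q = r - 1}"
          then have "finite Q" using fin by (auto intro: finite_subset)
          then have "card (insert i Q) = r" using Q r by (subst card_insert_disjoint) auto
          then have "insert i Q \<in> ?C i" using Q S True by (auto simp: cliques_def)
          moreover have "insert i Q - {i} = Q" using Q by auto
          ultimately show "Q \<in> (\<lambda>Q. Q - {i}) ` ?C i"
            by (intro image_eqI[where x = "insert i Q"]) simp_all
        qed
      qed (use clique_links(1)[of i r G] N in simp)
      then have "clique_degree r G i = card {Q. Q \<subseteq> S - {i} \<and> card Q = r - 1}"
        using clique_links(2)[of i r G] by simp
      then show ?thesis using fin True SV by (simp add: n_subsets)
    qed
    finally show ?thesis
      using True G.pair_finite_verts r by (simp add: tensor_apply_clique_tensor)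
  next
    case False
    have "(\<Prod>j\<in>Q - {i}. ?x j) = 0" if Q: "Q \<in> ?C i" for Q
    proof -
      have cQ: "card (Q - {i}) = r - 1" "Q - {i} \<subseteq> neighbours G i"
        using clique_through_vertex[of Q r G i] Q by auto
      have "Q - {i} \<noteq> {}"
      proof
        assume empty: "Q - {i} = {}"
        show False using cQ(1) r unfolding empty by simp
      qed
      then obtain j where j: "j \<in> Q - {i}" by blast
      then have "(j, i) \<in> parcs G"
        using cQ(2) G.arcs_symmetric by (auto simp: neighbours_def)
      then have "j \<notin> S" using closed False by (auto simp: closed_in_def neighbours_def)
      moreover have "finite Q" using Q G.pair_finite_verts by (auto simp: cliques_def intro: finite_subset)
      ultimately show ?thesis using j by (intro prod_zero) auto
    qed
    then show ?thesis using False G.pair_finite_verts r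
      by (simp add: tensor_apply_clique_tensor)
  qed
  show ?thesis unfolding tensor_eigenvalue_def
    using row S(2) SV(1) by (intro exI[of _ ?x]) auto
qed

section \<open>The extremal problem\<close>

text \<open>
  Every vertex of \<open>S\<close> lies in an \<open>r\<close>-subset of \<open>S\<close>, so the degree bound applies to it, and its
  \<open>m - 1\<close> neighbours inside \<open>S\<close> already exhaust it.
\<close>
lemma closed_clique_if_degree_less:
  assumes G: "pair_graph G" and S: "S \<in> cliques m G" and r: "1 \<le> r" "r \<le> m"
    and deg: "\<And>K u. K \<in> cliques r G \<Longrightarrow> u \<in> K \<Longrightarrow> card (neighbours G u) < m"
  shows "closed_in S G"
  unfolding closed_in_def
proof
  fix a assume a: "a \<in> S"
  have fin: "finite S" using S pair_fin_digraph.pair_finite_verts[of G] G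
    by (auto simp: cliques_def pair_graph_def pair_digraph_def intro: finite_subset)
  have "\<exists>K. {a} \<subseteq> K \<and> K \<subseteq> S \<and> card K = r"
    using a r S fin by (intro exists_subset_between) (auto simp: cliques_def)
  then obtain K where K: "a \<in> K" "K \<subseteq> S" "card K = r" by auto
  then have "K \<in> cliques r G" using S by (auto simp: cliques_def)
  then have "card (neighbours G a) < m" using deg K(1) by blast
  moreover have "S - {a} \<subseteq> neighbours G a" "card (S - {a}) = m - 1"
    using clique_through_vertex[OF S a] by auto
  ultimately have "S - {a} = neighbours G a"
    using neighbours_basics(1)[OF G] by (intro card_seteq) auto
  then show "neighbours G a \<subseteq> S" by blast
qed

theorem theorem1p9:
  fixes T :: "'b pair_pre_digraph" and G :: "'a pair_pre_digraph" and t r n :: nat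
  assumes "undirected_tree T"
    and "card (pverts T) = t"
    and "3 \<le> r" and "r \<le> t - 1"
    and "\<exists>v\<in>pverts T. t - r \<le> card {w. (v, w) \<in> parcs T \<and> is_leaf T w}"
    and "pair_graph G"
    and "card (pverts G) = n"
    and "free_of T G"
  shows "clique_spectral_radius r G \<le> real ((t - 2) choose (r - 1)) \<and>
    (n \<ge> t - 1 \<longrightarrow>
      (clique_spectral_radius r G = real ((t - 2) choose (r - 1)) \<longleftrightarrow>
       (\<exists>H. is_component H G \<and> complete_digraph (t - 1) H)))"
proof -
  note G = \<open>pair_graph G\<close> and r = \<open>3 \<le> r\<close> \<open>r \<le> t - 1\<close>
  interpret G: pair_graph G by fact
  note fin = G.pair_finite_verts
  let ?B = "(t - 2) choose (r - 1)"
  have T: "pair_graph T" using assms(1) by (simp add: undirected_tree_def)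
  obtain v where v: "v \<in> pverts T" "t - r \<le> card {w. (v, w) \<in> parcs T \<and> is_leaf T w}"
    using assms(5) by blast
  have deg: "card (neighbours G u) < t - 1" if "K \<in> cliques r G" "u \<in> K" for K u
    using degree_less_if_free_of[OF T assms(2) _ _ v G assms(8) that] r by simp
  have Bpos: "0 < ?B" using r by simp
  \<comment> \<open>The alternatives are separated strictly, since a gap below \<open>?B\<close> is needed at every vertex.\<close>
  have cases: "clique_degree r G u < ?B \<or>
      (clique_degree r G u = ?B \<and> card (neighbours G u) = t - 2)" for u
  proof (cases "{S \<in> cliques r G. u \<in> S} = {}")
    case True
    then have "clique_degree r G u = 0" unfolding clique_degree_def by (simp only: card.empty)
    then show ?thesis using Bpos by simp
  next
    case False
    then have d: "card (neighbours G u) < t - 1" using deg by blast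
    note le = clique_degree_le_choose[OF G, of r u]
    show ?thesis
    proof (cases "card (neighbours G u) = t - 2")
      case True
      then show ?thesis using le by auto
    next
      case False
      then have "card (neighbours G u) \<le> t - 3" using d by simp
      then have "clique_degree r G u \<le> (t - 3) choose (r - 1)"
        using le binomial_right_mono order_trans by blast
      \<comment> \<open>Pascal's rule: lowering the degree by one loses a positive summand.\<close>
      moreover have "?B = ((t - 3) choose (r - 2)) + ((t - 3) choose (r - 1))"
      proof -
        have "t - 2 = Suc (t - 3)" "r - 1 = Suc (r - 2)" using r by simp_all
        then show ?thesis by simp
      qed
      moreover have "0 < (t - 3) choose (r - 2)" using r by simp
      ultimately show ?thesis by linarith
    qed
  qed
  have closed: "closed_in S G" if "S \<in> cliques (t - 1) G" for S
    using closed_clique_if_degree_less[OF G that _ r(2)] deg r(1) by auto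
  have le: "clique_spectral_radius r G \<le> real ?B"
    using clique_spectral_radius_le[OF fin r(1)] cases less_or_eq_imp_le by blast
  have component: "\<exists>H. is_component H G \<and> complete_digraph (t - 1) H"
    if eq: "clique_spectral_radius r G = real ?B"
  proof -
    \<comment> \<open>Clique degrees are integers, so if all were below \<open>?B\<close> the radius would be at most \<open>?B - 1\<close>.\<close>
    have "\<exists>u\<in>pverts G. \<not> clique_degree r G u \<le> ?B - 1"
    proof (rule ccontr)
      assume "\<not> ?thesis"
      then have "clique_spectral_radius r G \<le> real (?B - 1)"
        using clique_spectral_radius_le[OF fin r(1)] by blast
      then show False using eq Bpos by linarith
    qed
    then obtain u where u: "u \<in> pverts G"
        "clique_degree r G u = ?B" "card (neighbours G u) = t - 2"
      using cases Bpos by (metis Suc_pred' less_Suc_eq_le)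
    have "insert u (neighbours G u) \<in> cliques (Suc (card (neighbours G u))) G"
      using clique_of_clique_degree_eq[OF G u(1) r(1)] u r by simp
    moreover have "Suc (card (neighbours G u)) = t - 1" using u(3) r by simp
    ultimately have "insert u (neighbours G u) \<in> cliques (t - 1) G" by simp
    then show ?thesis using complete_component_of_closed_clique[OF G] closed by blast
  qed
  have "real ?B \<le> clique_spectral_radius r G"
    if H: "is_component H G" "complete_digraph (t - 1) H" for H
  proof -
    note S = clique_of_complete_component[OF H]
    have "tensor_eigenvalue (pverts G) r (clique_tensor r G) (of_nat (t - 1 - 1 choose (r - 1)))"
      using eigenvalue_of_closed_clique[OF G S closed[OF S(1)]] r by simp
    moreover have "t - 1 - 1 = t - 2" by simp
    ultimately show ?thesis
      using cmod_eigenvalue_le_clique_spectral_radius[OF fin] r by (metis norm_of_nat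
          le_trans one_le_numeral)
  qed
  then show ?thesis using le component by (auto intro: antisym)
qed

end
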